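(* Let $P=2^{<\omega}\mathbin{\dot\cup}[0,1]$ be the dcpo with the binary-expansion order defined in the context. For $s\in 2^{<\omega}$ let $a(s)=\min\pi([s])$. Define $h:P\to[0,1]$ by $h(r)=r$ for $r\in[0,1]$ and $h(s)=a(s)$ for $s\in 2^{<\omega}$. Then $h$ is a Scott-continuous surjection onto $[0,1]$ with its usual order.
   Context: Let $T=2^{<\omega}$ be the set of finite binary words with the prefix order $\preccurlyeq$, and $X=2^\omega$ the set of infinite binary sequences. For $s\in T$, $[s]=\{\alpha\in X: s \text{ is a prefix of }\alpha\}$. Let $\pi:X\to[0,1]$, $\pi(\alpha)=\sum_{n=0}^\infty \alpha(n)/2^{n+1}$. The poset $P=T\mathbin{\dot\cup}[0,1]$ (disjoint union) is ordered by: for $s,t\in T$, $s\le t$ iff $s\preccurlyeq t$; for $s\in T$, $r\in[0,1]$, $s\le r$ iff $r\in\pi([s])$; for $r,q\in[0,1]$, $r\le q$ iff $r=q$; no other comparabilities. It is a dcpo (every nonempty directed subset has a supremum). A map between dcpos is Scott-continuous if it is monotone and preserves suprema of directed sets. *)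

theory Defs
  imports Complex_Main "HOL-Library.Sublist" "HOL-Library.Lub_Glb"
begin

definition (in ord) directed :: "'a set \<Rightarrow> bool" where
  "directed D \<longleftrightarrow> D \<noteq> {} \<and> (\<forall>x\<in>D. \<forall>y\<in>D. \<exists>z\<in>D. x \<le> z \<and> y \<le> z)"

text \<open>The conclusion spells out \<open>isLub UNIV D x\<close>, see \<open>isLub_UNIV_iff\<close> below; that constant is
  not available inside the class.\<close>

class dcpo = order +
  assumes directed_has_lub:
    "directed D \<Longrightarrow> \<exists>x. (\<forall>y\<in>D. y \<le> x) \<and> (\<forall>u. (\<forall>y\<in>D. y \<le> u) \<longrightarrow> x \<le> u)"

definition scott_continuous :: "('a::dcpo \<Rightarrow> 'b::dcpo) \<Rightarrow> bool" where
  "scott_continuous f \<longleftrightarrow>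
     mono f \<and> (\<forall>D x. directed D \<longrightarrow> isLub UNIV D x \<longrightarrow> isLub UNIV (f ` D) (f x))"

lemma isLub_UNIV_iff:
  "isLub UNIV S (x::'a::order) \<longleftrightarrow> (\<forall>y\<in>S. y \<le> x) \<and> (\<forall>u. (\<forall>y\<in>S. y \<le> u) \<longrightarrow> x \<le> u)"
  by (auto simp: isLub_def leastP_def isUb_def setle_def setge_def)


typedef unit_interval = "{0..1::real}"
  by (intro exI[of _ 0]) simp

setup_lifting type_definition_unit_interval

instantiation unit_interval :: linorder
begin

lift_definition less_eq_unit_interval :: "unit_interval \<Rightarrow> unit_interval \<Rightarrow> bool" is "(\<le>)" .

lift_definition less_unit_interval :: "unit_interval \<Rightarrow> unit_interval \<Rightarrow> bool" is "(<)" .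

instance
  by standard (transfer, force)+

end

instance unit_interval :: dcpo
proof
  fix D :: "unit_interval set"
  assume "directed D"
  then have ne: "D \<noteq> {}" by (simp add: directed_def)
  define R where "R = Rep_unit_interval ` D"
  have R: "R \<noteq> {}" "R \<subseteq> {0..1}"
    using ne Rep_unit_interval by (auto simp: R_def)
  then have bdd: "bdd_above R" by (meson bdd_above_Icc bdd_above_mono)
  have "0 \<le> Sup R"
    using R bdd by (meson all_not_in_conv atLeastAtMost_iff cSup_upper2 subsetD)
  moreover have "Sup R \<le> 1" using R by (intro cSup_least) auto
  ultimately have Rep: "Rep_unit_interval (Abs_unit_interval (Sup R)) = Sup R"
    by (simp add: Abs_unit_interval_inverse)
  have "isLub UNIV D (Abs_unit_interval (Sup R))"
    unfolding isLub_UNIV_iff less_eq_unit_interval.rep_eq Rep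
    using R bdd by (auto simp: R_def intro!: cSup_upper cSup_least)
  then show "\<exists>x. (\<forall>y\<in>D. y \<le> x) \<and> (\<forall>u. (\<forall>y\<in>D. y \<le> u) \<longrightarrow> x \<le> u)"
    unfolding isLub_UNIV_iff ..
qed


definition cylinder :: "bool list \<Rightarrow> (nat \<Rightarrow> bool) set" where
  "cylinder s = {\<alpha>. \<forall>i<length s. \<alpha> i = s ! i}"

lemma cylinder_antimono: "prefix s t \<Longrightarrow> cylinder t \<subseteq> cylinder s"
  by (auto simp: cylinder_def prefix_def nth_append)

lemma summable_binary: "summable (\<lambda>n. of_bool (\<alpha> n) / 2 ^ (n + 1) :: real)"
  by (rule summable_comparison_test'[OF sums_summable[OF power_half_series], of 0])
     (auto simp: power_divide)

lemma binary_tail_bounds: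
  fixes \<alpha> :: "nat \<Rightarrow> bool" and k :: nat
  defines "f \<equiv> (\<lambda>n. of_bool (\<alpha> n) / 2 ^ (n + 1) :: real)"
  shows "sum f {..<k} \<le> suminf f" and "suminf f \<le> sum f {..<k} + 1 / 2 ^ k"
proof -
  have sf: "summable f" unfolding f_def by (rule summable_binary)
  show "sum f {..<k} \<le> suminf f"
    by (rule sum_le_suminf[OF sf]) (auto simp: f_def)
  have g: "(\<lambda>n. (1 / 2 ^ k) * (1 / 2) ^ Suc n :: real) sums ((1 / 2 ^ k) * 1)"
    by (rule sums_mult[OF power_half_series])
  have "(\<Sum>n. f (n + k)) \<le> (\<Sum>n. (1 / 2 ^ k) * (1 / 2) ^ Suc n :: real)"
    by (rule suminf_le[OF _ summable_ignore_initial_segment[OF sf] sums_summable[OF g]])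
       (auto simp: f_def power_divide power_add field_simps)
  also have "\<dots> = 1 / 2 ^ k" using g by (simp only: sums_iff mult_1_right)
  finally show "suminf f \<le> sum f {..<k} + 1 / 2 ^ k"
    using suminf_split_initial_segment[OF sf, of k] by simp
qed

lift_definition binary_value :: "(nat \<Rightarrow> bool) \<Rightarrow> unit_interval"
  is "\<lambda>\<alpha>. \<Sum>n. of_bool (\<alpha> n) / 2 ^ (n + 1)"
  using binary_tail_bounds[where k = 0] by simp

lemma binary_value_close:
  assumes "\<alpha> \<in> cylinder s" "\<beta> \<in> cylinder s"
  shows "\<bar>Rep_unit_interval (binary_value \<alpha>) - Rep_unit_interval (binary_value \<beta>)\<bar> \<le> 1 / 2 ^ length s"
proof -
  have "(\<Sum>n<length s. of_bool (\<alpha> n) / 2 ^ (n + 1) :: real)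
      = (\<Sum>n<length s. of_bool (\<beta> n) / 2 ^ (n + 1))"
    using assms by (intro sum.cong) (auto simp: cylinder_def)
  then show ?thesis
    unfolding binary_value.rep_eq
    using binary_tail_bounds[of \<alpha> "length s"] binary_tail_bounds[of \<beta> "length s"]
    by linarith
qed


text \<open>The poset \<open>P\<close>: the disjoint union of the finite binary words and \<open>[0,1]\<close>.\<close>

datatype tree_interval = Word "bool list" | Point unit_interval

instantiation tree_interval :: order
begin

fun less_eq_tree_interval :: "tree_interval \<Rightarrow> tree_interval \<Rightarrow> bool" where
  "Word s \<le> Word t \<longleftrightarrow> prefix s t"
| "Word s \<le> Point r \<longleftrightarrow> r \<in> binary_value ` cylinder s"
| "Point r \<le> Point q \<longleftrightarrow> r = q"
| "Point r \<le> Word s \<longleftrightarrow> False"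

definition less_tree_interval :: "tree_interval \<Rightarrow> tree_interval \<Rightarrow> bool" where
  "x < y \<longleftrightarrow> x \<le> y \<and> \<not> y \<le> (x::tree_interval)"

instance
proof
  fix x y z :: tree_interval
  show "x < y \<longleftrightarrow> x \<le> y \<and> \<not> y \<le> x" by (rule less_tree_interval_def)
  show "x \<le> x" by (cases x) auto
  show "x \<le> z" if "x \<le> y" "y \<le> z"
    using that
    by (cases x; cases y; cases z) (auto dest: prefix_order.trans cylinder_antimono)
  show "x = y" if "x \<le> y" "y \<le> x"
    using that by (cases x; cases y) auto
qed

end

instance tree_interval :: dcpo
proof
  fix D :: "tree_interval set"
  assume D: "directed D"
  then have ne: "D \<noteq> {}" and dir: "\<And>x y. x \<in> D \<Longrightarrow> y \<in> D \<Longrightarrow> \<exists>z\<in>D. x \<le> z \<and> y \<le> z"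
    by (auto simp: directed_def)
  have max: "\<exists>x. isLub UNIV D x" if "m \<in> D" "\<And>y. y \<in> D \<Longrightarrow> y \<le> m" for m
    using that by (auto simp: isLub_UNIV_iff)
  have "\<exists>x. isLub UNIV D x"
  proof (cases "\<exists>r. Point r \<in> D")
    case True
    then obtain r where r: "Point r \<in> D" ..
    have "y \<le> Point r" if yD: "y \<in> D" for y
    proof -
      obtain z where "z \<in> D" "y \<le> z" "Point r \<le> z" using dir[OF yD r] by blast
      then show ?thesis by (cases z) auto
    qed
    then show ?thesis using max r by blast
  next
    case False
    define W where "W = {s. Word s \<in> D}"
    have DW: "D = Word ` W"
    proof -
      have "d \<in> Word ` W" if "d \<in> D" for d using that False by (cases d) (auto simp: W_def)
      then show ?thesis by (auto simp: W_def)
    qed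
    have chain: "prefix s t" if "s \<in> W" "t \<in> W" "length s \<le> length t" for s t
    proof -
      obtain z where "z \<in> D" "Word s \<le> z" "Word t \<le> z"
        using dir[of "Word s" "Word t"] \<open>s \<in> W\<close> \<open>t \<in> W\<close> by (auto simp: W_def)
      then show ?thesis using DW that(3) by (auto intro: prefix_length_prefix)
    qed
    show ?thesis
    proof (cases "finite (length ` W)")
      case True
      have "length ` W \<noteq> {}" using ne DW by auto
      then obtain m where m: "m \<in> W" "length m = Max (length ` W)"
        using Max_in[OF True] by (metis imageE)
      then have "prefix s m" if "s \<in> W" for s
        using chain[OF that m(1)] that True by simp
      then have "y \<le> Word m" if "y \<in> D" for y using that by (auto simp: DW)
      then show ?thesis using max[of "Word m"] m(1) by (auto simp: DW)
    next
      case False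
      have long: "\<exists>s\<in>W. n < length s" for n
        by (metis False finite_nat_set_iff_bounded_le image_iff not_le)
      then obtain w where w: "\<And>n. w n \<in> W" "\<And>n. n < length (w n)" by metis
      define \<alpha> where "\<alpha> = (\<lambda>n. w n ! n)"
      have \<alpha>: "\<alpha> \<in> cylinder s" if "s \<in> W" for s
      proof -
        have "w i ! i = s ! i" if "i < length s" for i
          using chain[of s "w i"] chain[of "w i" s] w \<open>s \<in> W\<close> that
          by (metis nat_le_linear nth_append prefix_def)
        then show ?thesis by (auto simp: cylinder_def \<alpha>_def)
      qed
      have "Point (binary_value \<alpha>) \<le> u" if u: "\<forall>y\<in>D. y \<le> u" for u
      proof (cases u)
        case (Word t)
        obtain s where "s \<in> W" "length t < length s" using long by blast
        moreover have "prefix s t" using u Word \<open>s \<in> W\<close> by (auto simp: DW)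
        ultimately show ?thesis using prefix_length_le[of s t] by simp
      next
        case (Point r)
        have close: "\<bar>Rep_unit_interval (binary_value \<alpha>) - Rep_unit_interval r\<bar> \<le> (1 / 2) ^ n" for n
        proof -
          obtain s where s: "s \<in> W" "n < length s" using long by blast
          then obtain \<beta> where "\<beta> \<in> cylinder s" "r = binary_value \<beta>"
            using u Point by (auto simp: DW)
          then have "\<bar>Rep_unit_interval (binary_value \<alpha>) - Rep_unit_interval r\<bar> \<le> (1 / 2) ^ length s"
            using binary_value_close \<alpha>[OF s(1)] by (simp add: power_divide)
          also have "\<dots> \<le> (1 / 2) ^ n" using s(2) by (intro power_decreasing) auto
          finally show ?thesis .
        qed
        have "\<bar>Rep_unit_interval (binary_value \<alpha>) - Rep_unit_interval r\<bar> \<le> 0"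
          by (rule LIMSEQ_le_const[OF LIMSEQ_power_zero[of "1 / 2 :: real"]])
             (use close in auto)
        then show ?thesis using Point by (simp add: Rep_unit_interval_inject)
      qed
      then have "isLub UNIV D (Point (binary_value \<alpha>))"
        using \<alpha> by (auto simp: isLub_UNIV_iff DW)
      then show ?thesis ..
    qed
  qed
  then show "\<exists>x. (\<forall>y\<in>D. y \<le> x) \<and> (\<forall>u. (\<forall>y\<in>D. y \<le> u) \<longrightarrow> x \<le> u)"
    unfolding isLub_UNIV_iff .
qed

text \<open>\<open>a(s) = min \<pi>([s])\<close>, where \<open>\<pi>\<close> is \<^const>\<open>binary_value\<close> and \<open>[s]\<close> is \<^const>\<open>cylinder\<close>. The image is
  infinite, so \<^const>\<open>Min\<close> would not do; that the minimum is attained is shown below.\<close>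

definition left_endpoint :: "bool list \<Rightarrow> unit_interval" where
  "left_endpoint s = (LEAST x. x \<in> binary_value ` cylinder s)"

lemma zero_extension_min:
  "\<beta> \<in> cylinder s \<Longrightarrow> binary_value (\<lambda>i. i < length s \<and> s ! i) \<le> binary_value \<beta>"
  unfolding less_eq_unit_interval.rep_eq binary_value.rep_eq
  by (rule suminf_le[OF _ summable_binary summable_binary]) (auto simp: cylinder_def)

lemma left_endpoint_eq:
  "left_endpoint s = binary_value (\<lambda>i. i < length s \<and> s ! i)"
  unfolding left_endpoint_def
  by (rule Least_equality) (auto simp: zero_extension_min, auto simp: cylinder_def)

lemma left_endpoint_in: "left_endpoint s \<in> binary_value ` cylinder s"
  by (auto simp: left_endpoint_eq cylinder_def)

lemma left_endpoint_le: "x \<in> binary_value ` cylinder s \<Longrightarrow> left_endpoint s \<le> x"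
  by (auto simp: left_endpoint_eq zero_extension_min)

fun h :: "tree_interval \<Rightarrow> unit_interval" where
  "h (Point r) = r"
| "h (Word s) = left_endpoint s"

end

(* A directed set that misses its supremum consists of arbitrarily long words s, and the
   supremum is then a point r of every pi([s]). As pi([s]) has diameter at most 2^(-length s),
   the values a(s) <= r converge to r. *)

theory Submission
  imports Defs
begin

text \<open>Passing to a longer word shrinks the cylinder, so the minimum of its image can only
  grow; a point above a word lies in that image, hence above its minimum.\<close>

lemma mono_h: "mono h"
proof (rule monoI)
  fix x y :: tree_interval
  assume "x \<le> y"
  then show "h x \<le> h y"
    by (cases x; cases y)
       (auto intro!: left_endpoint_le intro: subsetD[OF image_mono[OF cylinder_antimono]]
         simp: left_endpoint_in)
qed

lemma Point_le_iff: "Point r \<le> x \<longleftrightarrow> x = Point r"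
  by (cases x) auto

text \<open>If word lengths in \<open>D\<close> were bounded, directedness would make a longest word
  the greatest element of \<open>D\<close>, so the supremum would belong to
  \<open>D\<close>.\<close>

lemma long_words_below_new_lub:
  assumes D: "directed D" and lub: "isLub UNIV D x" and x: "x \<notin> D"
  shows "\<exists>s. Word s \<in> D \<and> n < length s"
proof (rule ccontr)
  assume short: "\<not> ?thesis"
  \<comment> \<open>Points are maximal, so a point of \<open>D\<close> would equal the upper bound
    \<open>x\<close>, which is not in \<open>D\<close>.\<close>
  have word: "\<exists>s. d = Word s" if "d \<in> D" for d
    using that lub x by (cases d) (auto simp: isLub_UNIV_iff Point_le_iff)
  obtain d where "d \<in> D" using D by (auto simp: directed_def)
  then obtain s0 where "Word s0 \<in> D" using word by blast
  \<comment> \<open>All lengths are at most \<open>n\<close>, so \<open>Suc n\<close> is the strict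
    bound that yields a longest word.\<close>
  then obtain m where m: "Word m \<in> D" "\<And>s. Word s \<in> D \<Longrightarrow> length s \<le> length m"
    using ex_has_greatest_nat[of "\<lambda>s. Word s \<in> D" s0 length "Suc n"] short
    by (auto simp: not_less less_Suc_eq_le)
  have greatest: "d \<le> Word m" if d: "d \<in> D" for d
  proof -
    obtain z where z: "z \<in> D" "d \<le> z" "Word m \<le> z"
      using D d m(1) by (auto simp: directed_def)
    then obtain t where t: "z = Word t" using word by blast
    \<comment> \<open>\<open>t\<close> extends \<open>m\<close> but is no longer than
      \<open>m\<close>.\<close>
    then have "t = m" using z m(2)[of t] by (auto simp: prefix_def)
    then show ?thesis using z t by simp
  qed
  then have "x = Word m"
    using lub m(1) by (intro order.antisym) (auto simp: isLub_UNIV_iff)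
  then show False using m(1) x by simp
qed

text \<open>Both values lie in the image of \<open>cylinder s\<close>, whose diameter is at most
  \<open>(1 / 2) ^ length s\<close>.\<close>

lemma Rep_le_left_endpoint_add:
  assumes "Word s \<le> Point r"
  shows "Rep_unit_interval r \<le> Rep_unit_interval (left_endpoint s) + (1 / 2) ^ length s"
proof -
  obtain \<alpha> \<beta> where "\<alpha> \<in> cylinder s" "r = binary_value \<alpha>"
      "\<beta> \<in> cylinder s" "left_endpoint s = binary_value \<beta>"
    using assms left_endpoint_in[of s] by auto
  then show ?thesis
    using binary_value_close[of \<alpha> s \<beta>] by (simp add: power_divide)
qed

text \<open>Monotonicity gives the upper bound; only leastness needs the long words, and only when
  \<open>x\<close> is not in \<open>D\<close>.\<close>

lemma h_preserves_directed_lub: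
  assumes D: "directed D" and lub: "isLub UNIV D x"
  shows "isLub UNIV (h ` D) (h x)"
proof -
  have ub: "d \<le> x" if "d \<in> D" for d using lub that by (auto simp: isLub_UNIV_iff)
  have "h x \<le> u" if u: "\<And>d. d \<in> D \<Longrightarrow> h d \<le> u" for u
  proof (cases "x \<in> D")
    case True
    then show ?thesis by (rule u)
  next
    case False
    note long = long_words_below_new_lub[OF D lub False]
    show ?thesis
    proof (cases x)
      case (Word t)
      \<comment> \<open>A word cannot bound a strictly longer word, so this case is
        contradictory.\<close>
      obtain s where "Word s \<in> D" "length t < length s" using long by blast
      then show ?thesis using ub[of "Word s"] Word by (auto dest: prefix_length_le)
    next
      case (Point r)
      have "Rep_unit_interval r \<le> Rep_unit_interval u + (1 / 2) ^ n" for n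
      proof -
        obtain s where s: "Word s \<in> D" "n < length s" using long by blast
        \<comment> \<open>\<open>left_endpoint s\<close> is \<open>h (Word s)\<close>, hence at most
          \<open>u\<close>; the error vanishes as \<open>n\<close> grows.\<close>
        have "Rep_unit_interval r
            \<le> Rep_unit_interval (left_endpoint s) + (1 / 2) ^ length s"
          using ub[OF s(1)] Point by (simp only: Rep_le_left_endpoint_add)
        also have "\<dots> \<le> Rep_unit_interval u + (1 / 2) ^ n"
          using u[OF s(1)] s(2)
          by (intro add_mono power_decreasing) (auto simp: less_eq_unit_interval.rep_eq)
        finally show ?thesis .
      qed
      moreover have
        "(\<lambda>n. Rep_unit_interval u + (1 / 2) ^ n) \<longlonglongrightarrow> Rep_unit_interval u + 0"
        by (intro tendsto_intros LIMSEQ_power_zero) simp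
      ultimately have "Rep_unit_interval r \<le> Rep_unit_interval u"
        using LIMSEQ_le_const by fastforce
      then show ?thesis using Point by (simp add: less_eq_unit_interval.rep_eq)
    qed
  qed
  then show ?thesis
    using ub monoD[OF mono_h] by (auto simp: isLub_UNIV_iff)
qed

theorem proposition4p1:
  shows "scott_continuous h \<and> surj h"
proof
  show "scott_continuous h"
    unfolding scott_continuous_def using mono_h h_preserves_directed_lub by blast
  show "surj h" by (metis h.simps(1) surjI)
qed

end
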